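(* Let $K$ be a field, $S=K[x_1,\ldots,x_n]$, and let $I\subsetneq S$ be a nonzero monomial ideal whose minimal system of monomial generators is $G(I)=\{v_1,\ldots,v_m\}$ (so $m\ge 1$ is the minimal number of generators). For $j\in\{1,\ldots,n\}$ let $t_j:=|\{i : x_j \mid v_i\}|$, and let $k:=\max\{|P| : P\in \operatorname{Ass}(S/I)\}$. Then there exists $j\in\{1,\ldots,n\}$ such that $t_j\geq \left\lceil \frac{m}{k} \right\rceil$.
   Context: Every associated prime $P$ of $S/I$, for $I$ a monomial ideal, is a monomial prime ideal, i.e. generated by a subset of the variables $\{x_1,\ldots,x_n\}$; $|P|$ denotes the number of variables generating $P$ (equivalently, its height). $\operatorname{Ass}(S/I)$ is the set of associated primes of the $S$-module $S/I$. *)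

theory Defs
  imports
    "HOL-Library.Poly_Mapping"
    "HOL-Algebra.QuotRing"
    "HOL-Algebra.Module"
    "HOL-Algebra.Algebraic_Closure_Type"
begin

(* K[x_j : j in 'n]: finitely supported coefficient functions on the exponent vectors.
   The ring operations are those of the type class instances in Poly_Mapping. *)
type_synonym ('n, 'k) mpoly = "('n \<Rightarrow>\<^sub>0 nat) \<Rightarrow>\<^sub>0 'k"

(* the same ring as a record, which gives access to ideals and quotients of HOL-Algebra *)
abbreviation mpoly_ring :: "('n, 'k::comm_ring_1) mpoly ring"
  where "mpoly_ring \<equiv> ring_of_type_algebra"

definition monomial :: "('n \<Rightarrow>\<^sub>0 nat) \<Rightarrow> ('n, 'k::comm_ring_1) mpoly"
  where "monomial a = Poly_Mapping.single a 1"

definition Var :: "'n \<Rightarrow> ('n, 'k::comm_ring_1) mpoly"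
  where "Var j = monomial (Poly_Mapping.single j 1)"

definition monomial_ideal :: "('n, 'k::comm_ring_1) mpoly set \<Rightarrow> bool"
  where "monomial_ideal I \<longleftrightarrow> (\<exists>M \<subseteq> range monomial. I = Idl\<^bsub>mpoly_ring\<^esub> M)"

(* Over a field and with finitely many variables, every monomial ideal I has exactly one such G,
   usually denoted G(I), and it is finite. *)
definition minimal_monomial_generators ::
  "('n, 'k::comm_ring_1) mpoly set \<Rightarrow> ('n, 'k) mpoly set \<Rightarrow> bool"
  where "minimal_monomial_generators I G \<longleftrightarrow>
    G \<subseteq> range monomial \<and> Idl\<^bsub>mpoly_ring\<^esub> G = I \<and>
    (\<forall>H. H \<subset> G \<longrightarrow> Idl\<^bsub>mpoly_ring\<^esub> H \<noteq> I)"

(* R/I as an R-module: r acts as multiplication by its residue class *)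
definition quotient_module :: "('a, 'b) ring_scheme \<Rightarrow> 'a set \<Rightarrow> ('a, 'a set) module"
  where "quotient_module R I = ring.extend (R Quot I)
    \<lparr>module.smult = (\<lambda>r C. (I +>\<^bsub>R\<^esub> r) \<otimes>\<^bsub>R Quot I\<^esub> C)\<rparr>"

definition annihilator ::
  "('a, 'b) ring_scheme \<Rightarrow> ('a, 'm, 'c) module_scheme \<Rightarrow> 'm \<Rightarrow> 'a set"
  where "annihilator R M x = {r \<in> carrier R. r \<odot>\<^bsub>M\<^esub> x = \<zero>\<^bsub>M\<^esub>}"

definition Ass :: "('a, 'b) ring_scheme \<Rightarrow> ('a, 'm, 'c) module_scheme \<Rightarrow> 'a set set"
  where "Ass R M = {P. primeideal P R \<and> (\<exists>x \<in> carrier M. P = annihilator R M x)}"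

(* |P| for a monomial prime ideal P: the set A of variables generating P is unique. *)
definition num_vars :: "('n, 'k::comm_ring_1) mpoly set \<Rightarrow> nat"
  where "num_vars P = card (THE A. P = Idl\<^bsub>mpoly_ring\<^esub> (Var ` A))"

lemma quotient_module_simps [simp]:
  "carrier (quotient_module R I) = carrier (R Quot I)"
  "monoid.mult (quotient_module R I) = monoid.mult (R Quot I)"
  "one (quotient_module R I) = one (R Quot I)"
  "ring.zero (quotient_module R I) = ring.zero (R Quot I)"
  "add (quotient_module R I) = add (R Quot I)"
  "module.smult (quotient_module R I) r C = (I +>\<^bsub>R\<^esub> r) \<otimes>\<^bsub>R Quot I\<^esub> C"
  by (simp_all add: quotient_module_def ring.defs)

lemma module_quotient_module:
  assumes "cring R" "ideal I R"
  shows "module R (quotient_module R I)"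
proof -
  interpret R: cring R by fact
  interpret I: ideal I R by fact
  interpret Q: cring "R Quot I"
    using I.quotient_is_cring[OF assms(1)] .
  interpret h: ring_hom_ring R "R Quot I" "(+>\<^bsub>R\<^esub>) I"
    by (rule I.rcos_ring_hom_ring)
  show ?thesis
  proof (rule moduleI)
    show "cring R" by fact
    show "abelian_group (quotient_module R I)"
    proof (rule abelian_groupI)
      fix x assume "x \<in> carrier (quotient_module R I)"
      then show "\<exists>y\<in>carrier (quotient_module R I).
          y \<oplus>\<^bsub>quotient_module R I\<^esub> x = \<zero>\<^bsub>quotient_module R I\<^esub>"
        using Q.l_neg[of x] Q.a_inv_closed[of x] by auto
    qed (simp_all add: Q.a_ac)
  qed (simp_all add: Q.l_distr Q.r_distr Q.m_assoc)
qed

end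

theory Submission
  imports Defs
begin

text \<open>
  If an associated prime \<open>P\<close> of \<open>S/I\<close> is generated by a set \<open>A\<close> of variables, then \<open>P\<close> contains
  \<open>I\<close>, so every generator in \<open>G\<close> is divisible by some \<open>x\<^sub>j\<close> with \<open>j \<in> A\<close>. Hence the numbers \<open>t\<^sub>j\<close>
  for \<open>j \<in> A\<close> add up to at least \<open>|G|\<close>, and one of them is at least \<open>|G| / |A|\<close>, which is
  at least \<open>|G| / k\<close> because \<open>k\<close> is the largest size of an associated prime. Therefore a single
  such \<open>P\<close> is enough (\<open>exists_associated_prime_Idl_Var\<close>, \<open>exists_popular_element\<close>).

  To find one, choose a monomial \<open>u \<notin> I\<close> for which the set \<open>A\<close> of variables \<open>x\<^sub>j\<close> with
  \<open>x\<^sub>j u \<in> I\<close> is as large as possible. Multiplying \<open>u\<close> by further monomials without entering \<open>I\<close>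
  cannot lose a variable from this set and, by maximality, cannot gain one. So multiplying by
  variables outside \<open>A\<close>, one after the other, never leads into \<open>I\<close>, and \<open>I : u\<close> is exactly the
  ideal generated by \<open>A\<close> (\<open>exists_variable_colon\<close>). This ideal is prime
  (\<open>primeideal_Idl_Var\<close>), and it is the annihilator of the residue class of \<open>u\<close>.

  All computations use that a polynomial belongs to an ideal generated by monomials iff each
  exponent vector in its support does (\<open>mem_Idl_monomials_iff\<close>). In particular it belongs to
  the ideal generated by \<open>A\<close> iff each of its exponent vectors involves a variable of \<open>A\<close>.
\<close>

section \<open>Coefficients of products\<close>

text \<open>
  Only the pairs of exponents with sum \<open>a + b\<close> contribute to this coefficient. For leading
  exponents \<open>a\<close> and \<open>b\<close> this is the multiplicativity of leading coefficients.
\<close>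

lemma lookup_mult_unique_decomposition:
  fixes f g :: "'a::monoid_add \<Rightarrow>\<^sub>0 'b::semiring_0"
  assumes "\<And>a' b'. a' \<in> Poly_Mapping.keys f \<Longrightarrow> b' \<in> Poly_Mapping.keys g
    \<Longrightarrow> a' + b' = a + b \<Longrightarrow> a' = a \<and> b' = b"
  shows "Poly_Mapping.lookup (f * g) (a + b) = Poly_Mapping.lookup f a * Poly_Mapping.lookup g b"
proof -
  let ?h = "\<lambda>(a', b').
    (Poly_Mapping.lookup f a' * Poly_Mapping.lookup g b' when a + b = a' + b')"
  have "Poly_Mapping.lookup (f * g) (a + b) = Sum_any ?h"
    by (simp add: times_poly_mapping.rep_eq prod_fun_unfold_prod)
  also have "\<dots> = sum ?h {(a, b)}"
  proof (rule Sum_any.expand_superset)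
    show "{p. ?h p \<noteq> 0} \<subseteq> {(a, b)}"
    proof
      fix p assume p: "p \<in> {p. ?h p \<noteq> 0}"
      obtain a' b' where [simp]: "p = (a', b')" by fastforce
      from p have "a + b = a' + b'" "Poly_Mapping.lookup f a' \<noteq> 0" "Poly_Mapping.lookup g b' \<noteq> 0"
        by (auto simp: when_def split: if_splits)
      then show "p \<in> {(a, b)}"
        using assms[of a' b'] by (simp add: in_keys_iff)
    qed
  qed simp
  finally show ?thesis by simp
qed

lemma keys_monomial [simp]:
  "Poly_Mapping.keys (monomial a :: ('n, 'k::comm_ring_1) mpoly) = {a}"
  by (simp add: monomial_def)

lemma monomial_mult: "monomial a * monomial b = (monomial (a + b) :: ('n, 'k::comm_ring_1) mpoly)"
  by (simp add: monomial_def mult_single)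

lemma keys_mult_monomial:
  fixes f :: "('n, 'k::comm_ring_1) mpoly"
  shows "Poly_Mapping.keys (f * monomial u) = (\<lambda>a. a + u) ` Poly_Mapping.keys f"
proof
  show "Poly_Mapping.keys (f * monomial u) \<subseteq> (\<lambda>a. a + u) ` Poly_Mapping.keys f"
    using keys_mult[of f "monomial u"] by auto
next
  have "Poly_Mapping.lookup (f * monomial u) (a + u) = Poly_Mapping.lookup f a" for a
    using lookup_mult_unique_decomposition[of f "monomial u" a u] by (simp add: monomial_def)
  then show "(\<lambda>a. a + u) ` Poly_Mapping.keys f \<subseteq> Poly_Mapping.keys (f * monomial u)"
    by (auto simp: in_keys_iff)
qed

section \<open>Membership in monomial ideals\<close>

lemma mpoly_ring_simps [simp]:
  "carrier (mpoly_ring :: ('n, 'k::comm_ring_1) mpoly ring) = UNIV"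
  "monoid.mult (mpoly_ring :: ('n, 'k) mpoly ring) = (*)"
  "one (mpoly_ring :: ('n, 'k) mpoly ring) = 1"
  "ring.zero (mpoly_ring :: ('n, 'k) mpoly ring) = 0"
  "add (mpoly_ring :: ('n, 'k) mpoly ring) = (+)"
  by (simp_all add: ring_of_type_algebra_def fun_eq_iff)

lemma cring_mpoly_ring: "cring (mpoly_ring :: ('n, 'k::comm_ring_1) mpoly ring)"
  by (rule cring_from_type_algebra)

lemma ideal_mpoly_ringI:
  fixes J :: "('n, 'k::comm_ring_1) mpoly set"
  assumes "0 \<in> J"
    and "\<And>f g. f \<in> J \<Longrightarrow> g \<in> J \<Longrightarrow> f + g \<in> J"
    and mult: "\<And>f r. f \<in> J \<Longrightarrow> r * f \<in> J"
  shows "ideal J mpoly_ring"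
proof -
  interpret cring "mpoly_ring :: ('n, 'k) mpoly ring" by (rule cring_mpoly_ring)
  have uminus: "\<ominus>\<^bsub>mpoly_ring\<^esub> f = - f" for f :: "('n, 'k) mpoly"
    using sum_zero_eq_neg[of "-f" f] by simp
  have "- f \<in> J" if "f \<in> J" for f
    using mult[OF that, of "-1"] by simp
  then have "subgroup J (add_monoid mpoly_ring)"
    using assms uminus by (intro add.subgroupI) (auto simp: a_inv_def)
  then show ?thesis
    using mult by (intro idealI) (auto simp: mult.commute local.ring_axioms)
qed

lemma ideal_mpoly_ringD:
  assumes "ideal J (mpoly_ring :: ('n, 'k::comm_ring_1) mpoly ring)"
  shows "0 \<in> J" "f \<in> J \<Longrightarrow> g \<in> J \<Longrightarrow> f + g \<in> J" "f \<in> J \<Longrightarrow> r * f \<in> J"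
proof -
  interpret ideal J "mpoly_ring :: ('n, 'k) mpoly ring" by fact
  show "0 \<in> J" "f \<in> J \<Longrightarrow> g \<in> J \<Longrightarrow> f + g \<in> J" "f \<in> J \<Longrightarrow> r * f \<in> J"
    using additive_subgroup.zero_closed[OF is_additive_subgroup]
      additive_subgroup.a_closed[OF is_additive_subgroup] I_l_closed by simp_all
qed

lemma poly_mapping_sum_single:
  "f = (\<Sum>a\<in>Poly_Mapping.keys f. Poly_Mapping.single a (Poly_Mapping.lookup f a))"
  by (rule poly_mapping_eqI)
    (auto simp: lookup_sum lookup_single when_def in_keys_iff)

text \<open>
  The polynomials all of whose exponents lie above some element of \<open>B\<close> form an ideal that contains
  the generators. Conversely, each term of such a polynomial is a multiple of a generator.
\<close>

lemma mem_Idl_monomials_iff: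
  fixes f :: "('n, 'k::comm_ring_1) mpoly"
  shows "f \<in> Idl\<^bsub>mpoly_ring\<^esub> (monomial ` B) \<longleftrightarrow>
    (\<forall>a\<in>Poly_Mapping.keys f. \<exists>b\<in>B. \<exists>c. a = b + c)"
proof -
  interpret cring "mpoly_ring :: ('n, 'k) mpoly ring" by (rule cring_mpoly_ring)
  let ?I = "Idl\<^bsub>mpoly_ring\<^esub> (monomial ` B) :: ('n, 'k) mpoly set"
  define J :: "('n, 'k) mpoly set"
    where "J = {f. \<forall>a\<in>Poly_Mapping.keys f. \<exists>b\<in>B. \<exists>c. a = b + c}"
  have "ideal J mpoly_ring"
  proof (rule ideal_mpoly_ringI)
    show "f + g \<in> J" if "f \<in> J" "g \<in> J" for f g
      using that keys_add[of f g] unfolding J_def by blast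
    show "r * f \<in> J" if "f \<in> J" for f r
    proof -
      have "\<exists>b\<in>B. \<exists>c. k = b + c" if k: "k \<in> Poly_Mapping.keys (r * f)" for k
      proof -
        obtain d a where "k = d + a" "a \<in> Poly_Mapping.keys f"
          using k keys_mult[of r f] by blast
        moreover obtain b c where "b \<in> B" "a = b + c"
          using \<open>f \<in> J\<close> \<open>a \<in> _\<close> unfolding J_def by blast
        ultimately have "k = b + (d + c)" by (simp add: ac_simps)
        then show ?thesis using \<open>b \<in> B\<close> by blast
      qed
      then show ?thesis unfolding J_def by blast
    qed
  qed (simp add: J_def)
  moreover have "monomial ` B \<subseteq> J"
    unfolding J_def by (auto intro!: exI[of _ 0])
  ultimately have "?I \<subseteq> J"
    by (rule genideal_minimal)
  moreover have "J \<subseteq> ?I"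
  proof
    fix f assume "f \<in> J"
    have I: "ideal ?I mpoly_ring"
      by (rule genideal_ideal) simp
    have term_in: "Poly_Mapping.single a (Poly_Mapping.lookup f a) \<in> ?I"
      if a: "a \<in> Poly_Mapping.keys f" for a
    proof -
      obtain b c where b: "b \<in> B" "a = b + c"
        using \<open>f \<in> J\<close> a unfolding J_def by blast
      have "(monomial b :: ('n, 'k) mpoly) \<in> ?I"
        using genideal_self[of "monomial ` B"] b(1) by auto
      then have "Poly_Mapping.single c (Poly_Mapping.lookup f a) * monomial b \<in> ?I"
        by (rule ideal_mpoly_ringD(3)[OF I])
      then show ?thesis
        by (simp add: monomial_def mult_single b(2) add.commute)
    qed
    have "(\<Sum>a\<in>F. Poly_Mapping.single a (Poly_Mapping.lookup f a)) \<in> ?I"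
      if "finite F" "F \<subseteq> Poly_Mapping.keys f" for F
      using that
    proof (induction F rule: finite_induct)
      case empty
      then show ?case using ideal_mpoly_ringD(1)[OF I] by simp
    next
      case (insert a F)
      then show ?case using ideal_mpoly_ringD(2)[OF I] term_in by simp
    qed
    then show "f \<in> ?I"
      using poly_mapping_sum_single[of f] by (metis finite_keys order_refl)
  qed
  ultimately show ?thesis unfolding J_def by blast
qed

lemma mem_monomial_ideal_iff:
  fixes I :: "('n, 'k::comm_ring_1) mpoly set"
  assumes "monomial_ideal I"
  shows "f \<in> I \<longleftrightarrow> (\<forall>a\<in>Poly_Mapping.keys f. monomial a \<in> I)"
proof -
  obtain B where "I = Idl\<^bsub>mpoly_ring\<^esub> (monomial ` B)"
    using assms unfolding monomial_ideal_def by (auto simp: subset_image_iff)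
  then show ?thesis by (simp add: mem_Idl_monomials_iff)
qed

lemma ideal_monomial_ideal:
  fixes I :: "('n, 'k::comm_ring_1) mpoly set"
  assumes "monomial_ideal I"
  shows "ideal I mpoly_ring"
proof -
  interpret cring "mpoly_ring :: ('n, 'k) mpoly ring" by (rule cring_mpoly_ring)
  show ?thesis
    using assms genideal_ideal unfolding monomial_ideal_def by auto
qed

section \<open>Ideals generated by variables\<close>

lemma keys_add_nat:
  fixes a b :: "'n \<Rightarrow>\<^sub>0 nat"
  shows "Poly_Mapping.keys (a + b) = Poly_Mapping.keys a \<union> Poly_Mapping.keys b"
  by (auto simp: in_keys_iff lookup_add)

lemma in_keys_iff_add_single:
  fixes a :: "'n \<Rightarrow>\<^sub>0 nat"
  shows "j \<in> Poly_Mapping.keys a \<longleftrightarrow> (\<exists>c. a = Poly_Mapping.single j 1 + c)"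
proof
  assume "j \<in> Poly_Mapping.keys a"
  then have "a = Poly_Mapping.single j 1 + (a - Poly_Mapping.single j 1)"
    by (intro poly_mapping_eqI)
      (auto simp: lookup_add lookup_minus lookup_single when_def in_keys_iff)
  then show "\<exists>c. a = Poly_Mapping.single j 1 + c" by blast
qed (auto simp: in_keys_iff lookup_add)

lemma mem_Idl_Var_iff:
  fixes f :: "('n, 'k::comm_ring_1) mpoly"
  shows "f \<in> Idl\<^bsub>mpoly_ring\<^esub> (Var ` A) \<longleftrightarrow>
    (\<forall>a\<in>Poly_Mapping.keys f. Poly_Mapping.keys a \<inter> A \<noteq> {})"
proof -
  have "(Var ` A :: ('n, 'k) mpoly set) = monomial ` (\<lambda>j. Poly_Mapping.single j 1) ` A"
    by (simp add: Var_def image_image)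
  moreover have "Poly_Mapping.keys a \<inter> A \<noteq> {} \<longleftrightarrow>
      (\<exists>b\<in>(\<lambda>j. Poly_Mapping.single j 1) ` A. \<exists>c. a = b + c)" for a :: "'n \<Rightarrow>\<^sub>0 nat"
    using in_keys_iff_add_single[of _ a] by blast
  ultimately show ?thesis
    by (simp only: mem_Idl_monomials_iff)
qed

text \<open>
  The generating set is determined by the ideal, since it consists of the variables that
  the ideal contains.
\<close>

lemma num_vars_Idl_Var:
  "num_vars (Idl\<^bsub>mpoly_ring\<^esub> (Var ` A) :: ('n, 'k::comm_ring_1) mpoly set) = card A"
proof -
  have "B = A" if "Idl\<^bsub>mpoly_ring\<^esub> (Var ` A) = (Idl\<^bsub>mpoly_ring\<^esub> (Var ` B) :: ('n, 'k) mpoly set)" for B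
  proof -
    have mem: "(Var j :: ('n, 'k) mpoly) \<in> Idl\<^bsub>mpoly_ring\<^esub> (Var ` C) \<longleftrightarrow> j \<in> C" for j C
      by (subst mem_Idl_Var_iff) (simp add: Var_def)
    show ?thesis using mem[of _ A] mem[of _ B] that by blast
  qed
  then have "(THE B. Idl\<^bsub>mpoly_ring\<^esub> (Var ` A) = (Idl\<^bsub>mpoly_ring\<^esub> (Var ` B) :: ('n, 'k) mpoly set)) = A"
    by (intro the_equality) auto
  then show ?thesis by (simp add: num_vars_def)
qed

lemma finite_image_attains_max:
  fixes f :: "'a \<Rightarrow> 'b::linorder"
  assumes "finite (f ` S)" and "S \<noteq> {}"
  obtains x where "x \<in> S" and "\<And>y. y \<in> S \<Longrightarrow> f y \<le> f x"
proof -
  obtain x where "x \<in> S" "f x = Max (f ` S)"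
    using Max_in[of "f ` S"] assms by (metis imageE image_is_empty)
  then show ?thesis using Max_ge[OF assms(1)] that[of x] by auto
qed

text \<open>
  The indices \<open>'n\<close> carry no order. An enumeration of them moves exponent vectors to
  \<open>nat \<Rightarrow>\<^sub>0 nat\<close>, whose order is compatible with addition; pulled back along the embedding it
  is a monomial order.
\<close>

lemma additive_embedding_exponents:
  obtains e :: "('n::finite \<Rightarrow>\<^sub>0 nat) \<Rightarrow> (nat \<Rightarrow>\<^sub>0 nat)"
  where "inj e" "\<And>a b. e (a + b) = e a + e b"
proof -
  obtain h :: "'n \<Rightarrow> nat" where h: "inj h"
    using finite_imp_inj_to_nat_seg[OF finite[of "UNIV :: 'n set"]] by auto
  define e where
    "e = (\<lambda>a :: 'n \<Rightarrow>\<^sub>0 nat. \<Sum>j\<in>UNIV. Poly_Mapping.single (h j) (Poly_Mapping.lookup a j))"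
  have lookup_e: "Poly_Mapping.lookup (e a) (h j) = Poly_Mapping.lookup a j" for a j
    using h by (simp add: e_def lookup_sum lookup_single when_def inj_eq)
  have "inj e"
    by (rule injI, rule poly_mapping_eqI) (metis lookup_e)
  moreover have "e (a + b) = e a + e b" for a b
    by (simp add: e_def lookup_add single_add sum.distrib)
  ultimately show ?thesis by (rule that)
qed

text \<open>
  Modulo the variables in \<open>A\<close>, two polynomials outside the ideal have leading terms with
  respect to a monomial order, and the product of these terms does not cancel.
\<close>

lemma primeideal_Idl_Var:
  fixes A :: "'n::finite set"
  shows "primeideal (Idl\<^bsub>mpoly_ring\<^esub> (Var ` A)) (mpoly_ring :: ('n, 'k::idom) mpoly ring)"
proof -
  interpret cring "mpoly_ring :: ('n, 'k) mpoly ring" by (rule cring_mpoly_ring)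
  let ?P = "Idl\<^bsub>mpoly_ring\<^esub> (Var ` A) :: ('n, 'k) mpoly set"
  obtain e :: "('n \<Rightarrow>\<^sub>0 nat) \<Rightarrow> (nat \<Rightarrow>\<^sub>0 nat)"
    where e: "inj e" "\<And>a b. e (a + b) = e a + e b"
    using additive_embedding_exponents by blast
  define free where
    "free f = {a \<in> Poly_Mapping.keys f. Poly_Mapping.keys a \<inter> A = {}}" for f :: "('n, 'k) mpoly"
  have mem: "f \<in> ?P \<longleftrightarrow> free f = {}" for f
    by (auto simp: mem_Idl_Var_iff free_def)
  have free_finite: "finite (e ` free f)" for f
    by (simp add: free_def)
  have prime: "f * g \<notin> ?P" if fg: "f \<notin> ?P" "g \<notin> ?P" for f g
  proof -
    obtain a where a: "a \<in> free f" "\<And>a'. a' \<in> free f \<Longrightarrow> e a' \<le> e a"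
      using finite_image_attains_max[OF free_finite[of f]] fg(1) unfolding mem by blast
    obtain b where b: "b \<in> free g" "\<And>b'. b' \<in> free g \<Longrightarrow> e b' \<le> e b"
      using finite_image_attains_max[OF free_finite[of g]] fg(2) unfolding mem by blast
    have ab: "Poly_Mapping.keys (a + b) \<inter> A = {}"
      using a(1) b(1) by (auto simp: free_def keys_add_nat)
    \<comment> \<open>A factor of a monomial without variables from \<open>A\<close> has none either, so the terms of
      \<open>f\<close> and \<open>g\<close> inside the ideal do not interfere with the leading ones.\<close>
    have "a' = a \<and> b' = b"
      if a': "a' \<in> Poly_Mapping.keys f" and b': "b' \<in> Poly_Mapping.keys g"
        and eq: "a' + b' = a + b" for a' b'
    proof -
      have "Poly_Mapping.keys (a' + b') \<inter> A = {}" using ab eq by simp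
      then have "a' \<in> free f" "b' \<in> free g"
        using a' b' by (auto simp: free_def keys_add_nat)
      then have "e a' \<le> e a" "e b' \<le> e b" using a(2) b(2) by auto
      moreover have "e a' + e b' = e a + e b" using eq e(2) by metis
      ultimately have "e a' = e a"
        by (metis add_less_le_mono order_le_imp_less_or_eq less_irrefl)
      then have "a' = a" using e(1) by (simp add: inj_eq)
      then show ?thesis using eq by simp
    qed
    then have "Poly_Mapping.lookup (f * g) (a + b) = Poly_Mapping.lookup f a * Poly_Mapping.lookup g b"
      by (rule lookup_mult_unique_decomposition)
    then have "a + b \<in> Poly_Mapping.keys (f * g)"
      using a(1) b(1) by (auto simp: free_def in_keys_iff)
    then have "a + b \<in> free (f * g)"
      using ab by (simp add: free_def)
    then show ?thesis by (auto simp: mem)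
  qed
  show ?thesis
  proof (rule primeidealI)
    show "ideal ?P mpoly_ring" by (rule genideal_ideal) simp
    show "carrier mpoly_ring \<noteq> ?P"
    proof -
      have "1 \<notin> ?P" by (simp add: mem_Idl_Var_iff)
      then show ?thesis by auto
    qed
  qed (use prime in \<open>auto simp: cring_mpoly_ring\<close>)
qed

section \<open>An associated prime of a monomial ideal\<close>

lemma annihilator_quotient_module:
  fixes I :: "('n, 'k::comm_ring_1) mpoly set"
  assumes "ideal I mpoly_ring"
  shows "annihilator mpoly_ring (quotient_module mpoly_ring I) (I +>\<^bsub>mpoly_ring\<^esub> u) = {r. r * u \<in> I}"
proof -
  interpret cring "mpoly_ring :: ('n, 'k) mpoly ring" by (rule cring_mpoly_ring)
  interpret ideal I "mpoly_ring :: ('n, 'k) mpoly ring" by fact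
  have "(I +>\<^bsub>mpoly_ring\<^esub> r) \<otimes>\<^bsub>mpoly_ring Quot I\<^esub> (I +>\<^bsub>mpoly_ring\<^esub> u)
      = I +>\<^bsub>mpoly_ring\<^esub> (r * u)" for r
    using rcoset_mult_add[of r u] by (simp add: FactRing_def)
  moreover have "I +>\<^bsub>mpoly_ring\<^esub> f = \<zero>\<^bsub>mpoly_ring Quot I\<^esub> \<longleftrightarrow> f \<in> I" for f
  proof
    assume "I +>\<^bsub>mpoly_ring\<^esub> f = \<zero>\<^bsub>mpoly_ring Quot I\<^esub>"
    then show "f \<in> I" by (intro rcos_const_imp_mem) (simp_all add: FactRing_def)
  next
    assume "f \<in> I"
    then show "I +>\<^bsub>mpoly_ring\<^esub> f = \<zero>\<^bsub>mpoly_ring Quot I\<^esub>"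
      using a_rcos_zero[OF assms] by (simp add: FactRing_def)
  qed
  ultimately have "(I +>\<^bsub>mpoly_ring\<^esub> r) \<otimes>\<^bsub>mpoly_ring Quot I\<^esub> (I +>\<^bsub>mpoly_ring\<^esub> u)
      = \<zero>\<^bsub>mpoly_ring Quot I\<^esub> \<longleftrightarrow> r * u \<in> I" for r
    by metis
  then show ?thesis by (simp add: annihilator_def)
qed

text \<open>
  For a monomial \<open>u\<close> outside \<open>I\<close> let \<open>A u\<close> be the set of variables that carry \<open>u\<close> into \<open>I\<close>. It
  can only grow when \<open>u\<close> is replaced by a multiple outside \<open>I\<close>. If \<open>u\<close> maximises \<open>card (A u)\<close>, it
  therefore stays constant along all such multiples, and no product of variables outside
  \<open>A u\<close> carries \<open>u\<close> into \<open>I\<close>. As there are finitely many variables, such a \<open>u\<close> exists without an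
  appeal to the Noetherian property.
\<close>

lemma exists_variable_colon:
  fixes I :: "('n::finite, 'k::comm_ring_1) mpoly set"
  assumes I: "monomial_ideal I" and "I \<noteq> UNIV"
  obtains A u where "{r. r * monomial u \<in> I} = Idl\<^bsub>mpoly_ring\<^esub> (Var ` A)"
proof -
  note ideal = ideal_mpoly_ringD[OF ideal_monomial_ideal[OF I]]
  have mono_up: "monomial (a + c) \<in> I" if "monomial a \<in> I" for a c
    using ideal(3)[OF that, of "monomial c"] by (simp add: monomial_mult add.commute)
  define A where "A u = {j. monomial (Poly_Mapping.single j 1 + u) \<in> I}" for u
  have one: "monomial 0 \<notin> I"
  proof
    assume "monomial 0 \<in> I"
    then have "f * 1 \<in> I" for f using ideal(3)[of 1 f] by (simp add: monomial_def)
    then show False using \<open>I \<noteq> UNIV\<close> by auto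
  qed
  define cands where "cands = {u. monomial u \<notin> I}"
  have "finite ((\<lambda>u. card (A u)) ` cands)"
    by (rule finite_subset[of _ "card ` UNIV"]) auto
  moreover have "cands \<noteq> {}"
    using one by (auto simp: cands_def)
  ultimately obtain u
    where u: "u \<in> cands" "\<And>v. v \<in> cands \<Longrightarrow> card (A v) \<le> card (A u)"
    using finite_image_attains_max[of "\<lambda>u. card (A u)" cands] by blast
  have A_const: "A (w + u) = A u" if "w + u \<in> cands" for w
  proof (rule sym, rule card_seteq)
    show "A u \<subseteq> A (w + u)"
      using mono_up[of "Poly_Mapping.single _ 1 + u" w] by (auto simp: A_def ac_simps)
  qed (use u(2)[OF that] in auto)
  have outside: "w + u \<in> cands" if "Poly_Mapping.keys w \<inter> A u = {}" for w
    using that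
  proof (induction "\<Sum>j\<in>UNIV. Poly_Mapping.lookup w j" arbitrary: w rule: less_induct)
    case less
    show ?case
    proof (cases "w = 0")
      case True
      then show ?thesis using u(1) by simp
    next
      case False
      then obtain j where j: "j \<in> Poly_Mapping.keys w"
        by (metis poly_mapping_eqI in_keys_iff lookup_zero)
      then obtain w' where w': "w = Poly_Mapping.single j 1 + w'"
        by (auto simp: in_keys_iff_add_single)
      have "(\<Sum>i\<in>UNIV. Poly_Mapping.lookup w' i) < (\<Sum>i\<in>UNIV. Poly_Mapping.lookup w i)"
        by (simp add: w' lookup_add sum.distrib lookup_single when_def)
      moreover have "Poly_Mapping.keys w' \<inter> A u = {}"
        using less.prems by (auto simp: w' keys_add_nat)
      ultimately have "w' + u \<in> cands" by (rule less.hyps)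
      moreover from this have "j \<notin> A (w' + u)" using A_const less.prems j by auto
      ultimately show ?thesis by (simp add: A_def cands_def w' ac_simps)
    qed
  qed
  have mono: "monomial (w + u) \<in> I \<longleftrightarrow> Poly_Mapping.keys w \<inter> A u \<noteq> {}" for w
  proof
    assume "Poly_Mapping.keys w \<inter> A u \<noteq> {}"
    then obtain j where "j \<in> A u" "j \<in> Poly_Mapping.keys w" by blast
    moreover from this obtain c where "w = Poly_Mapping.single j 1 + c"
      unfolding in_keys_iff_add_single by blast
    ultimately show "monomial (w + u) \<in> I"
      using mono_up[of "Poly_Mapping.single j 1 + u" c] by (simp add: A_def ac_simps)
  qed (use outside in \<open>auto simp: cands_def\<close>)
  have "r * monomial u \<in> I \<longleftrightarrow> r \<in> Idl\<^bsub>mpoly_ring\<^esub> (Var ` A u)" for r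
    by (subst mem_monomial_ideal_iff[OF I]) (simp add: keys_mult_monomial mono mem_Idl_Var_iff)
  then show ?thesis by (intro that[of u "A u"]) auto
qed

lemma exists_associated_prime_Idl_Var:
  fixes I :: "('n::finite, 'k::idom) mpoly set"
  assumes I: "monomial_ideal I" and "I \<noteq> UNIV"
  obtains A where "Idl\<^bsub>mpoly_ring\<^esub> (Var ` A) \<in> Ass mpoly_ring (quotient_module mpoly_ring I)"
    and "I \<subseteq> Idl\<^bsub>mpoly_ring\<^esub> (Var ` A)"
proof -
  obtain A u where A: "{r. r * monomial u \<in> I} = Idl\<^bsub>mpoly_ring\<^esub> (Var ` A)"
    using exists_variable_colon[OF assms] .
  have ideal: "ideal I mpoly_ring" by (rule ideal_monomial_ideal[OF I])
  show ?thesis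
  proof (rule that)
    have "I +>\<^bsub>mpoly_ring\<^esub> monomial u \<in> carrier (quotient_module mpoly_ring I)"
      by (auto simp: FactRing_def A_RCOSETS_def')
    then show "Idl\<^bsub>mpoly_ring\<^esub> (Var ` A) \<in> Ass mpoly_ring (quotient_module mpoly_ring I)"
      using annihilator_quotient_module[OF ideal, of "monomial u"] A primeideal_Idl_Var[of A]
      unfolding Ass_def by auto
    show "I \<subseteq> Idl\<^bsub>mpoly_ring\<^esub> (Var ` A)"
      using ideal_mpoly_ringD(3)[OF ideal, of _ "monomial u"]
      by (auto simp flip: A simp: mult.commute)
  qed
qed

section \<open>Counting generators\<close>

text \<open>
  Double counting: the sets \<open>{v \<in> G. R j v}\<close> for \<open>j \<in> A\<close> cover \<open>G\<close>. If each of them had fewer than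
  \<open>card G / k\<close> elements, then these at most \<open>k\<close> sets would have fewer than \<open>card G\<close> elements
  together. Multiplying by \<open>k\<close> instead of dividing includes the case \<open>k = 0\<close>.
\<close>

lemma exists_popular_element:
  fixes R :: "'a \<Rightarrow> 'b \<Rightarrow> bool"
  assumes "finite A" "card A \<le> k" and cover: "\<And>v. v \<in> G \<Longrightarrow> \<exists>j\<in>A. R j v"
  shows "\<exists>j. card G \<le> card {v \<in> G. R j v} * k"
proof (rule ccontr)
  assume neg: "\<nexists>j. card G \<le> card {v \<in> G. R j v} * k"
  then have "card G > 0" by (metis gr0I le0)
  then have fin: "finite G" "G \<noteq> {}" by (auto simp: card_gt_0_iff)
  then have "A \<noteq> {}" using cover by auto
  have "G = (\<Union>j\<in>A. {v \<in> G. R j v})" using cover by auto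
  then have "card G \<le> (\<Sum>j\<in>A. card {v \<in> G. R j v})"
    using card_UN_le[OF \<open>finite A\<close>, of "\<lambda>j. {v \<in> G. R j v}"] by simp
  then have "card G * k \<le> (\<Sum>j\<in>A. card {v \<in> G. R j v} * k)"
    by (simp flip: sum_distrib_right)
  also have "\<dots> < (\<Sum>j\<in>A. card G)"
    using neg \<open>A \<noteq> {}\<close> \<open>finite A\<close> by (intro sum_strict_mono) (auto simp: not_le)
  also have "\<dots> \<le> card G * k" using \<open>card A \<le> k\<close> by simp
  finally show False by simp
qed

lemma Var_dvd_monomial:
  assumes "j \<in> Poly_Mapping.keys a"
  shows "Var j dvd (monomial a :: ('n, 'k::comm_ring_1) mpoly)"
proof -
  obtain c where "a = Poly_Mapping.single j 1 + c"
    using assms unfolding in_keys_iff_add_single by blast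
  then have "(monomial a :: ('n, 'k) mpoly) = Var j * monomial c"
    by (simp add: Var_def monomial_mult)
  then show ?thesis by (rule dvdI)
qed

theorem lemma1p5:
  fixes I G :: "('n::finite, 'k::field) mpoly set"
  assumes "monomial_ideal I"
    and "I \<noteq> {0}"
    and "I \<noteq> UNIV"
    and "minimal_monomial_generators I G"
  shows "\<exists>j. int (card {v \<in> G. Var j dvd v}) \<ge>
    \<lceil>real (card G) /
      real (Max (num_vars ` Ass mpoly_ring (quotient_module mpoly_ring I)))\<rceil>"
proof -
  interpret cring "mpoly_ring :: ('n, 'k) mpoly ring" by (rule cring_mpoly_ring)
  let ?N = "num_vars ` Ass mpoly_ring (quotient_module mpoly_ring I)"
  obtain A where A: "Idl\<^bsub>mpoly_ring\<^esub> (Var ` A) \<in> Ass mpoly_ring (quotient_module mpoly_ring I)"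
    and I_sub: "I \<subseteq> Idl\<^bsub>mpoly_ring\<^esub> (Var ` A)"
    using exists_associated_prime_Idl_Var[OF assms(1,3)] .
  \<comment> \<open>Whichever set of variables the definite description in \<open>num_vars\<close> denotes, its size is
    bounded by the number of variables, so the maximum is taken over a finite set.\<close>
  have "num_vars P \<le> card (UNIV :: 'n set)" for P :: "('n, 'k) mpoly set"
    unfolding num_vars_def by (simp add: card_mono)
  then have "finite ?N"
    by (intro finite_subset[of ?N "{..card (UNIV :: 'n set)}"]) auto
  moreover have "card A \<in> ?N"
    using A by (metis num_vars_Idl_Var image_eqI)
  ultimately have k: "card A \<le> Max ?N" by simp
  have G: "G \<subseteq> range monomial" "Idl\<^bsub>mpoly_ring\<^esub> G = I"
    using assms(4) by (auto simp: minimal_monomial_generators_def)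
  then have "G \<subseteq> I" using genideal_self[of G] by simp
  have "\<exists>j\<in>A. Var j dvd v" if v: "v \<in> G" for v
  proof -
    obtain a where a: "v = monomial a" using G(1) v by auto
    have "v \<in> Idl\<^bsub>mpoly_ring\<^esub> (Var ` A)" using v \<open>G \<subseteq> I\<close> I_sub by auto
    then obtain j where "j \<in> A" "j \<in> Poly_Mapping.keys a"
      unfolding mem_Idl_Var_iff a by auto
    then show ?thesis unfolding a by (intro bexI[of _ j] Var_dvd_monomial)
  qed
  then obtain j where j: "card G \<le> card {v \<in> G. Var j dvd v} * Max ?N"
    using exists_popular_element[of A "Max ?N" G "\<lambda>j v. Var j dvd v"] k by auto
  have "real (card G) / real (Max ?N) \<le> real (card {v \<in> G. Var j dvd v})"
    using j by (cases "Max ?N = 0") (simp_all add: divide_le_eq flip: of_nat_mult)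
  then have "\<lceil>real (card G) / real (Max ?N)\<rceil> \<le> int (card {v \<in> G. Var j dvd v})"
    by (simp add: ceiling_le_iff)
  then show ?thesis by blast
qed

end
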